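(* The following identity holds in any hoop: \[ (e\rightarrow e+e)\rightarrow\bigl((e\rightarrow x+y)\rightarrow\bigl((e\rightarrow x)+(e\rightarrow y)\bigr)\bigr)=0 . \]
   Context: A pocrim is a structure $\mathbf{P}=(P;0,+,\rightarrow)$ such that, writing $x\ge y$ for $x\rightarrow y=0$: $(P;0,+)$ is a commutative monoid; $\ge$ is a partial order on $P$; $x\ge y$ implies $x+z\ge y+z$; $x\ge 0$ for all $x$; and $x+y\ge z$ iff $x\ge y\rightarrow z$. A hoop is a pocrim satisfying $x+(x\rightarrow y)=y+(y\rightarrow x)$. The operation $\rightarrow$ binds less tightly than $+$, so $e\rightarrow e+e$ means $e\rightarrow(e+e)$ and $e\rightarrow x+y$ means $e\rightarrow(x+y)$. *)

theory Defs imports Main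
begin

locale pocrim_signature =
  fixes zero :: 'a ("\<^bold>0")
    and add :: "'a \<Rightarrow> 'a \<Rightarrow> 'a" (infixl "\<^bold>+" 65)
    and imp :: "'a \<Rightarrow> 'a \<Rightarrow> 'a" (infixr "\<^bold>\<rightarrow>" 60)
begin

definition ge :: "'a \<Rightarrow> 'a \<Rightarrow> bool" (infix "\<^bold>\<ge>" 50)
  where "x \<^bold>\<ge> y \<longleftrightarrow> x \<^bold>\<rightarrow> y = \<^bold>0"

end

locale pocrim = pocrim_signature zero add imp + comm_monoid add zero
  for zero :: 'a ("\<^bold>0")
    and add :: "'a \<Rightarrow> 'a \<Rightarrow> 'a" (infixl "\<^bold>+" 65)
    and imp :: "'a \<Rightarrow> 'a \<Rightarrow> 'a" (infixr "\<^bold>\<rightarrow>" 60) +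
  assumes ge_refl: "x \<^bold>\<ge> x"
    and ge_antisym: "x \<^bold>\<ge> y \<Longrightarrow> y \<^bold>\<ge> x \<Longrightarrow> x = y"
    and ge_trans: "x \<^bold>\<ge> y \<Longrightarrow> y \<^bold>\<ge> z \<Longrightarrow> x \<^bold>\<ge> z"
    and add_mono: "x \<^bold>\<ge> y \<Longrightarrow> x \<^bold>+ z \<^bold>\<ge> y \<^bold>+ z"
    and ge_zero: "x \<^bold>\<ge> \<^bold>0"
    and residuation: "x \<^bold>+ y \<^bold>\<ge> z \<longleftrightarrow> x \<^bold>\<ge> y \<^bold>\<rightarrow> z"

locale hoop = pocrim +
  assumes divisibility: "x \<^bold>+ (x \<^bold>\<rightarrow> y) = y \<^bold>+ (y \<^bold>\<rightarrow> x)"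

end

theory Submission imports Defs
begin

text \<open>
  Put \<open>d = e \<rightarrow> e + e\<close>, \<open>z = e \<rightarrow> x + y\<close>, \<open>w = (e \<rightarrow> x) + (e \<rightarrow> y)\<close> and \<open>n = z \<rightarrow> w\<close>.
  Both \<open>z + z \<ge> w\<close> and \<open>e + z \<ge> w\<close>, that is \<open>z \<ge> n\<close> and \<open>e \<ge> n\<close>.
  The former gives \<open>z = n + (n \<rightarrow> z)\<close> by divisibility; the latter gives
  \<open>d + (n \<rightarrow> z) \<ge> d + (e \<rightarrow> z) = d + (e + e \<rightarrow> x + y) \<ge> z\<close>.
  Hence \<open>d + z = n + (d + (n \<rightarrow> z)) \<ge> n + z \<ge> w\<close>.
\<close>

context pocrim
begin

lemma add_mono_left: "x \<^bold>\<ge> y \<Longrightarrow> z \<^bold>+ x \<^bold>\<ge> z \<^bold>+ y"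
  using add_mono[of x y z] by (simp add: commute)

lemma add_mono_both: "x \<^bold>\<ge> y \<Longrightarrow> u \<^bold>\<ge> v \<Longrightarrow> x \<^bold>+ u \<^bold>\<ge> y \<^bold>+ v"
  using add_mono add_mono_left ge_trans by blast

lemma add_ge_left: "x \<^bold>+ y \<^bold>\<ge> x"
  using add_mono_left[OF ge_zero, of x y] by simp

lemma add_ge_right: "x \<^bold>+ y \<^bold>\<ge> y"
  using add_ge_left[of y x] by (simp add: commute)

lemma modus_ponens: "(x \<^bold>\<rightarrow> y) \<^bold>+ x \<^bold>\<ge> y"
  using residuation ge_refl by blast

lemma ge_imp: "y \<^bold>\<ge> x \<^bold>\<rightarrow> y"
  using residuation add_ge_left by blast

lemma imp_mono: "y \<^bold>\<ge> z \<Longrightarrow> x \<^bold>\<rightarrow> y \<^bold>\<ge> x \<^bold>\<rightarrow> z"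
  using residuation modus_ponens ge_trans by blast

lemma imp_antimono: "x \<^bold>\<ge> y \<Longrightarrow> y \<^bold>\<rightarrow> z \<^bold>\<ge> x \<^bold>\<rightarrow> z"
  using residuation modus_ponens add_mono_left ge_trans by blast

lemma imp_imp_ge: "x \<^bold>\<rightarrow> (y \<^bold>\<rightarrow> z) \<^bold>\<ge> x \<^bold>+ y \<^bold>\<rightarrow> z"
  using modus_ponens[of x "y \<^bold>\<rightarrow> z"] residuation by (metis assoc)

text \<open>Adding \<open>x\<close> and regrouping lets modus ponens fire twice, first reaching
  \<open>y\<close> and then \<open>z\<close>; residuation then moves \<open>x\<close> back.\<close>

lemma imp_comp: "(x \<^bold>\<rightarrow> y) \<^bold>+ (y \<^bold>\<rightarrow> z) \<^bold>\<ge> x \<^bold>\<rightarrow> z"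
proof -
  have "(y \<^bold>\<rightarrow> z) \<^bold>+ ((x \<^bold>\<rightarrow> y) \<^bold>+ x) \<^bold>\<ge> (y \<^bold>\<rightarrow> z) \<^bold>+ y"
    by (rule add_mono_left[OF modus_ponens])
  then have "((x \<^bold>\<rightarrow> y) \<^bold>+ (y \<^bold>\<rightarrow> z)) \<^bold>+ x \<^bold>\<ge> z"
    using ge_trans[OF _ modus_ponens] by (simp add: ac_simps)
  then show ?thesis
    by (simp add: residuation)
qed

end

context hoop
begin

text \<open>Here \<open>x \<rightarrow> y\<close> is zero, so one side of divisibility collapses to
  \<open>x\<close>. This is the only appeal to the hoop axiom.\<close>

lemma ge_decompose: "x \<^bold>\<ge> y \<Longrightarrow> y \<^bold>+ (y \<^bold>\<rightarrow> x) = x"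
  using divisibility[of x y] by (simp add: ge_def)

lemma imp_add_ge: "(e \<^bold>\<rightarrow> e \<^bold>+ e) \<^bold>+ (e \<^bold>\<rightarrow> x \<^bold>+ y) \<^bold>\<ge> (e \<^bold>\<rightarrow> x) \<^bold>+ (e \<^bold>\<rightarrow> y)"
proof -
  define d z w where "d = e \<^bold>\<rightarrow> e \<^bold>+ e" and "z = e \<^bold>\<rightarrow> x \<^bold>+ y"
    and "w = (e \<^bold>\<rightarrow> x) \<^bold>+ (e \<^bold>\<rightarrow> y)"
  define n where "n = z \<^bold>\<rightarrow> w"
  \<comment> \<open>One copy of \<open>z\<close> pays for each summand of \<open>w\<close>, because
    \<open>x + y\<close> lies above both \<open>x\<close> and \<open>y\<close>.\<close>
  have "z \<^bold>+ z \<^bold>\<ge> w"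
    unfolding z_def w_def by (intro add_mono_both imp_mono add_ge_left add_ge_right)
  then have "z \<^bold>\<ge> n"
    by (simp add: n_def residuation)
  have "z \<^bold>+ e \<^bold>\<ge> x \<^bold>+ y"
    unfolding z_def by (rule modus_ponens)
  moreover have "x \<^bold>+ y \<^bold>\<ge> w"
    unfolding w_def by (intro add_mono_both ge_imp)
  ultimately have "e \<^bold>+ z \<^bold>\<ge> w"
    using ge_trans by (simp add: commute)
  then have "e \<^bold>\<ge> n"
    by (simp add: n_def residuation)
  then have "n \<^bold>\<rightarrow> z \<^bold>\<ge> e \<^bold>\<rightarrow> z"
    by (rule imp_antimono)
  \<comment> \<open>\<open>e \<rightarrow> z\<close> is a nested implication with premise
    \<open>e\<close> twice; currying merges the two into \<open>e + e\<close>.\<close>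
  then have "n \<^bold>\<rightarrow> z \<^bold>\<ge> e \<^bold>+ e \<^bold>\<rightarrow> x \<^bold>+ y"
    unfolding z_def using imp_imp_ge ge_trans by blast
  then have "d \<^bold>+ (n \<^bold>\<rightarrow> z) \<^bold>\<ge> d \<^bold>+ (e \<^bold>+ e \<^bold>\<rightarrow> x \<^bold>+ y)"
    by (rule add_mono_left)
  \<comment> \<open>Composition through the middle term \<open>e + e\<close>: \<open>d\<close> leads
    from \<open>e\<close> to it.\<close>
  then have "d \<^bold>+ (n \<^bold>\<rightarrow> z) \<^bold>\<ge> z"
    unfolding d_def z_def using imp_comp ge_trans by blast
  then have "n \<^bold>+ (d \<^bold>+ (n \<^bold>\<rightarrow> z)) \<^bold>\<ge> n \<^bold>+ z"
    by (rule add_mono_left)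
  moreover have "n \<^bold>+ (d \<^bold>+ (n \<^bold>\<rightarrow> z)) = d \<^bold>+ z"
    using ge_decompose[OF \<open>z \<^bold>\<ge> n\<close>] by (metis left_commute)
  moreover have "n \<^bold>+ z \<^bold>\<ge> w"
    unfolding n_def by (rule modus_ponens)
  ultimately have "d \<^bold>+ z \<^bold>\<ge> w"
    using ge_trans by simp
  then show ?thesis
    by (simp add: d_def z_def w_def)
qed

end

theorem theorem4p4p1:
  fixes zero :: 'a ("\<^bold>0")
    and add :: "'a \<Rightarrow> 'a \<Rightarrow> 'a" (infixl "\<^bold>+" 65)
    and imp :: "'a \<Rightarrow> 'a \<Rightarrow> 'a" (infixr "\<^bold>\<rightarrow>" 60)
    and e x y :: 'a
  assumes "hoop zero add imp"
  shows "(e \<^bold>\<rightarrow> e \<^bold>+ e) \<^bold>\<rightarrow> ((e \<^bold>\<rightarrow> x \<^bold>+ y) \<^bold>\<rightarrow> ((e \<^bold>\<rightarrow> x) \<^bold>+ (e \<^bold>\<rightarrow> y))) = \<^bold>0"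
proof -
  interpret hoop zero add imp by fact
  show ?thesis
    \<comment> \<open>Residuation turns the nested implication being zero into the inequality for
      the sum of its two premises.\<close>
    using imp_add_ge residuation by (simp add: ge_def)
qed

end
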